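(* There exists a universal constant $C>0$ such that the following holds. Let $G=(V,E)$ be a finite simple undirected graph with $|V|=n$ vertices and maximum degree $\Delta$, let $A$ be its adjacency matrix, let $k\ge 2$ be an integer, and let $A^{(k)}$ be the adjacency matrix of the random $k$-lift $G^{(k)}$ of $G$. Then for every $\epsilon\in(0,1/2]$, $$\mathbb{E}\,\|A^{(k)}-\mathbb{E}A^{(k)}\| \le 2(1+\epsilon)\sqrt{\Delta} + \frac{C}{\sqrt{\log(1+\epsilon)}}\sqrt{\log(kn)}.$$
   Context: $\|\cdot\|$ is the spectral (operator) norm, $\mathbb{E}A^{(k)}$ is the entrywise expectation, and $\log$ is the natural logarithm. Random $k$-lift: given an undirected graph $G=(V,E)$ and an integer $k\ge2$, the random $k$-lift $G^{(k)}$ is the random graph obtained by replacing each vertex $v\in V$ by $k$ new vertices, and each edge $e=(v_1,v_2)\in E$ by a random perfect bipartite matching between the $k$ new vertices corresponding to $v_1$ and the $k$ new vertices corresponding to $v_2$, chosen uniformly among all $k!$ such matchings, independently over the edges of $G$. Thus, identifying $V$ with $\{1,\dots,n\}$, $A^{(k)}$ is the symmetric $kn\times kn$ matrix whose $k\times k$ block $(i,j)$ is $0$ if $\{i,j\}\notin E$, and for each edge $\{i,j\}\in E$ with $i<j$ is an independent uniformly random $k\times k$ permutation matrix $\Pi_{ij}$, with block $(j,i)$ equal to $\Pi_{ij}^\top$. *)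

theory Defs
  imports "HOL-Probability.Product_PMF" "HOL-Combinatorics.Permutations" "Jordan_Normal_Form.Matrix"
begin

text \<open>A graph on the vertex set \<open>{..<n}\<close> is given by its set \<open>E\<close> of edges, an edge being an
  unordered pair of distinct vertices. Concrete vertices are used so that constants can be
  chosen uniformly over all graphs.\<close>

definition simple_graph :: "nat \<Rightarrow> nat set set \<Rightarrow> bool" where
  "simple_graph n E \<longleftrightarrow> E \<subseteq> {{u, v} | u v. u < n \<and> v < n \<and> u \<noteq> v}"

definition degree_of :: "nat set set \<Rightarrow> nat \<Rightarrow> nat" where
  "degree_of E v = card {e \<in> E. v \<in> e}"

definition max_degree :: "nat \<Rightarrow> nat set set \<Rightarrow> nat" where
  "max_degree n E = Max (degree_of E ` {..<n})"

definition adjacency_mat :: "nat \<Rightarrow> nat set set \<Rightarrow> real mat" where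
  "adjacency_mat n E = mat n n (\<lambda>(u, v). if {u, v} \<in> E then 1 else 0)"

text \<open>The vertex \<open>v\<close> is replaced by the \<open>k\<close> vertices \<open>v * k + a\<close> with \<open>a < k\<close>, so that the adjacency
  matrix of a lift consists of \<open>k \<times> k\<close> blocks. The perfect matching replacing the edge
  \<open>{i, j}\<close>, where \<open>i < j\<close>, is encoded by the permutation \<open>\<pi> {i, j}\<close> of \<open>{..<k}\<close>.\<close>

definition lift_edges :: "nat \<Rightarrow> nat set set \<Rightarrow> (nat set \<Rightarrow> nat \<Rightarrow> nat) \<Rightarrow> nat set set" where
  "lift_edges k E \<pi> =
     {{i * k + a, j * k + \<pi> {i, j} a} | i j a. {i, j} \<in> E \<and> i < j \<and> a < k}"

text \<open>The edge set of the random \<open>k\<close>-lift. The default value \<open>id\<close> of the product distribution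
  outside \<open>E\<close> is never used.\<close>

definition random_lift :: "nat \<Rightarrow> nat set set \<Rightarrow> nat set set pmf" where
  "random_lift k E =
     map_pmf (lift_edges k E) (Pi_pmf E id (\<lambda>_. pmf_of_set {p. p permutes {..<k}}))"

definition random_lift_mat :: "nat \<Rightarrow> nat \<Rightarrow> nat set set \<Rightarrow> real mat pmf" where
  "random_lift_mat n k E = map_pmf (adjacency_mat (k * n)) (random_lift k E)"

definition expectation_mat :: "nat \<Rightarrow> real mat pmf \<Rightarrow> real mat" where
  "expectation_mat N p = mat N N (\<lambda>(u, v). measure_pmf.expectation p (\<lambda>M. M $$ (u, v)))"

definition euclidean_norm :: "real Matrix.vec \<Rightarrow> real" where
  "euclidean_norm x = sqrt (x \<bullet> x)"

definition spectral_norm :: "real mat \<Rightarrow> real" where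
  "spectral_norm M =
     (SUP x \<in> {x \<in> carrier_vec (dim_col M). euclidean_norm x \<le> 1}. euclidean_norm (M *\<^sub>v x))"

end

theory Submission
  imports Defs
begin

text \<open>
  Let \<open>X\<close> be the centered lift. By the moment method, the expectation of \<open>\<parallel>X\<parallel>\<^sup>2\<^sup>p\<close> is at most that of
  the trace of \<open>X\<^sup>2\<^sup>p\<close>, which is a sum over closed walks of length \<open>2p\<close> in the base graph. The blocks
  of \<open>X\<close> are independent, centered contractions, so a walk contributes nothing if it uses some edge
  exactly once, and at most \<open>k\<close> otherwise.

  To count the walks that use each of their edges at least twice, record along the walk the current
  vertex and the set \<open>S\<close> of open edges, those that were used before and will be used again. Every step
  opens an edge, closes an edge of \<open>S\<close>, or uses an edge of \<open>S\<close> that stays open. On functions of \<open>(v, S)\<close>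
  supported on \<open>|S| \<le> N\<close>, the first two operators are adjoint to each other, as creation and
  annihilation operators are, and have \<open>L\<^sup>2\<close> norm at most \<open>\<surd>(\<Delta> + 2N)\<close>; the third has norm at most
  \<open>\<surd>(2N)\<close>. Since at most \<open>2p\<close> edges are open at any time, there are at most
  \<open>(2\<surd>\<Delta> + 6\<surd>p)\<^sup>2\<^sup>p\<close> such walks from each vertex, and \<open>p\<close> of order \<open>log (kn) / log (1 + \<epsilon>)\<close> gives the
  theorem.
\<close>

section \<open>Walks and their open edges\<close>

lemma sum_Pow_remove:
  fixes f :: "'a set \<Rightarrow> real"
  assumes "finite E" "e \<in> E"
  shows "(\<Sum>S\<in>{S \<in> Pow E. e \<in> S}. f (S - {e}) ) = (\<Sum>S\<in>{S \<in> Pow E. e \<notin> S}. f S)"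
  by (rule sum.reindex_bij_witness[where i = "insert e" and j = "\<lambda>S. S - {e}"]) (use assms in auto)

section \<open>Neighbourhoods in subgraphs\<close>

locale simple_finite_graph =
  fixes n :: nat and E :: "nat set set"
  assumes simple: "simple_graph n E"
begin

definition nbh :: "nat set set \<Rightarrow> nat \<Rightarrow> nat set" where
  "nbh S v = {w. w < n \<and> {v, w} \<in> S}"

lemma finite_nbh [simp]: "finite (nbh S v)"
  by (simp add: nbh_def)

lemma finite_E: "finite E"
proof (rule finite_subset)
  show "E \<subseteq> Pow {..<n}" using simple by (auto simp: simple_graph_def)
qed simp

lemma edge_neq: "{v, w} \<in> E \<Longrightarrow> v \<noteq> w"
  using simple by (fastforce simp: simple_graph_def doubleton_eq_iff)

lemma card_nbh_le_degree: "card (nbh E v) \<le> degree_of E v"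
  unfolding degree_of_def
proof (rule card_inj_on_le)
  show "inj_on (\<lambda>w. {v, w}) (nbh E v)" by (auto simp: inj_on_def doubleton_eq_iff)
  show "(\<lambda>w. {v, w}) ` nbh E v \<subseteq> {e \<in> E. v \<in> e}" by (auto simp: nbh_def)
  show "finite {e \<in> E. v \<in> e}" using finite_E by simp
qed

lemma card_nbh_le: "v < n \<Longrightarrow> card (nbh E v) \<le> max_degree n E"
  using card_nbh_le_degree[of v] unfolding max_degree_def
  by (meson Max_ge dual_order.trans finite_imageI finite_lessThan imageI lessThan_iff)

text \<open>Handshake lemma for the subgraph \<open>S\<close>: an edge is seen once from each of its
  two ends.\<close>

lemma sum_card_nbh_le:
  assumes "S \<subseteq> E"
  shows "(\<Sum>v<n. card (nbh S v)) \<le> 2 * card S"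
proof -
  have fin: "finite S" using assms finite_E finite_subset by blast
  have "(\<Sum>v<n. card (nbh S v)) = card (SIGMA v:{..<n}. nbh S v)"
    by (simp add: card_SigmaI)
  also have "\<dots> \<le> card (\<Union>e\<in>S. {(v, w). {v, w} = e \<and> v < n \<and> w < n})"
  proof (rule card_mono)
    show "finite (\<Union>e\<in>S. {(v, w). {v, w} = e \<and> v < n \<and> w < n})"
      by (rule finite_subset[of _ "{..<n} \<times> {..<n}"]) auto
  qed (auto simp: nbh_def)
  also have "\<dots> \<le> (\<Sum>e\<in>S. card {(v, w). {v, w} = e \<and> v < n \<and> w < n})"
    by (rule card_UN_le[OF fin])
  also have "\<dots> \<le> (\<Sum>e\<in>S. 2)"
  proof (rule sum_mono)
    fix e assume "e \<in> S"
    then obtain x y where e: "e = {x, y}" using assms simple by (auto simp: simple_graph_def)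
    have "{(v, w). {v, w} = e \<and> v < n \<and> w < n} \<subseteq> {(x, y), (y, x)}"
      unfolding e by (clarsimp simp: doubleton_eq_iff)
    then have "card {(v, w). {v, w} = e \<and> v < n \<and> w < n} \<le> card {(x, y), (y, x)}"
      by (rule card_mono[rotated]) (intro finite.intros)
    also have "\<dots> \<le> 2" using card_length[of "[(x, y), (y, x)]"] by (simp only: list.set) simp
    finally show "card {(v, w). {v, w} = e \<and> v < n \<and> w < n} \<le> 2" .
  qed
  finally show ?thesis by simp
qed

text \<open>A state of a walk is its current vertex together with the set \<open>S\<close> of its open edges: those
  that were used before and will be used again.\<close>

definition states :: "(nat \<times> nat set set) set" where
  "states = {..<n} \<times> Pow E"

lemma finite_states: "finite states"
  by (simp add: states_def finite_E)

lemma sum_states: "(\<Sum>s\<in>states. f s) = (\<Sum>v<n. \<Sum>S\<in>Pow E. f (v, S))"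
  by (simp add: states_def sum.cartesian_product)

text \<open>The three operators are backward recursions: \<open>g\<close> is evaluated at the state
  reached after one step from \<open>(v, S)\<close>. Iterated on the indicator of a final state,
  they count the ways to reach it.\<close>

definition close_step :: "(nat \<times> nat set set \<Rightarrow> real) \<Rightarrow> nat \<times> nat set set \<Rightarrow> real" where
  "close_step g = (\<lambda>(v, S). \<Sum>w\<in>nbh S v. g (w, S - {{v, w}}))"

definition open_step :: "(nat \<times> nat set set \<Rightarrow> real) \<Rightarrow> nat \<times> nat set set \<Rightarrow> real" where
  "open_step g = (\<lambda>(v, S). \<Sum>w\<in>nbh (E - S) v. g (w, insert {v, w} S))"

definition keep_step :: "(nat \<times> nat set set \<Rightarrow> real) \<Rightarrow> nat \<times> nat set set \<Rightarrow> real" where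
  "keep_step g = (\<lambda>(v, S). \<Sum>w\<in>nbh S v. g (w, S))"

text \<open>A cutoff in the number of open edges, like a particle number cutoff. It makes the
  operator bounds depend on \<open>N\<close> instead of on \<open>card E\<close>.\<close>

definition few_open :: "nat \<Rightarrow> (nat \<times> nat set set \<Rightarrow> real) \<Rightarrow> bool" where
  "few_open N g \<longleftrightarrow> (\<forall>v S. S \<subseteq> E \<longrightarrow> card S > N \<longrightarrow> g (v, S) = 0)"

section \<open>Adjointness and norms of the step operators\<close>

lemma sum_nbh: "(\<Sum>w\<in>nbh S v. f w) = (\<Sum>w<n. if {v, w} \<in> S then f w else 0)"
  by (simp add: nbh_def sum.If_cases Collect_conj_eq lessThan_def)

text \<open>Change of variables from the edge set before an edge is closed to the one after:
  removing \<open>{v, w}\<close> is a bijection from the sets that contain it to those that do not.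
  Both the adjointness and the bound for closing rest on this.\<close>

lemma sum_transition:
  fixes F :: "nat \<Rightarrow> nat \<Rightarrow> nat set set \<Rightarrow> real"
  shows "(\<Sum>v<n. \<Sum>S\<in>Pow E. \<Sum>w\<in>nbh S v. F v w (S - {{v, w}}))
       = (\<Sum>w<n. \<Sum>S\<in>Pow E. \<Sum>v\<in>nbh (E - S) w. F v w S)"
proof -
  have inner: "(\<Sum>S\<in>Pow E. if {v, w} \<in> S then F v w (S - {{v, w}}) else 0)
    = (\<Sum>S\<in>Pow E. if {w, v} \<in> E - S then F v w S else 0)" for v w
  proof (cases "{v, w} \<in> E")
    case True
    have "(\<Sum>S\<in>Pow E. if {v, w} \<in> S then F v w (S - {{v, w}}) else 0)
      = (\<Sum>S\<in>{S \<in> Pow E. {v, w} \<in> S}. F v w (S - {{v, w}}))"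
      by (rule sum.inter_filter[symmetric]) (simp add: finite_E)
    also have "\<dots> = (\<Sum>S\<in>{S \<in> Pow E. {v, w} \<notin> S}. F v w S)"
      by (rule sum_Pow_remove[OF finite_E True])
    also have "\<dots> = (\<Sum>S\<in>Pow E. if {v, w} \<notin> S then F v w S else 0)"
      by (rule sum.inter_filter) (simp add: finite_E)
    finally show ?thesis using True by (simp add: insert_commute)
  next
    case False
    then show ?thesis by (intro sum.cong) (auto simp: insert_commute)
  qed
  have "(\<Sum>v<n. \<Sum>S\<in>Pow E. \<Sum>w\<in>nbh S v. F v w (S - {{v, w}}))
      = (\<Sum>v<n. \<Sum>w<n. \<Sum>S\<in>Pow E. if {v, w} \<in> S then F v w (S - {{v, w}}) else 0)"
    unfolding sum_nbh by (intro sum.cong refl sum.swap)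
  also have "\<dots> = (\<Sum>w<n. \<Sum>v<n. \<Sum>S\<in>Pow E. if {w, v} \<in> E - S then F v w S else 0)"
    unfolding inner by (rule sum.swap)
  also have "\<dots> = (\<Sum>w<n. \<Sum>S\<in>Pow E. \<Sum>v\<in>nbh (E - S) w. F v w S)"
    unfolding sum_nbh by (intro sum.cong refl sum.swap)
  finally show ?thesis .
qed

text \<open>Closing an edge on the way from \<open>v\<close> to \<open>w\<close> is, read backwards,
  opening it on the way from \<open>w\<close> to \<open>v\<close>.\<close>

lemma close_open_adjoint:
  "(\<Sum>s\<in>states. close_step h s * g s) = (\<Sum>s\<in>states. h s * open_step g s)"
proof -
  have "(\<Sum>s\<in>states. close_step h s * g s)
      = (\<Sum>v<n. \<Sum>S\<in>Pow E. \<Sum>w\<in>nbh S v.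
           h (w, S - {{v, w}}) * g (v, insert {v, w} (S - {{v, w}})))"
    unfolding sum_states close_step_def
    by (auto intro!: sum.cong simp: sum_distrib_right nbh_def insert_absorb)
  also have "\<dots> = (\<Sum>w<n. \<Sum>S\<in>Pow E. \<Sum>v\<in>nbh (E - S) w. h (w, S) * g (v, insert {v, w} S))"
    by (rule sum_transition[where F = "\<lambda>v w S. h (w, S) * g (v, insert {v, w} S)"])
  also have "\<dots> = (\<Sum>s\<in>states. h s * open_step g s)"
    unfolding sum_states open_step_def by (simp add: sum_distrib_left insert_commute)
  finally show ?thesis .
qed

text \<open>Cauchy-Schwarz costs a factor \<open>card (nbh S v)\<close>. After the change of
  variables, \<open>w\<close> and the smaller set are fixed and this factor is summed over
  \<open>v\<close>. The handshake lemma bounds the sum by \<open>2 * N\<close>, and the removed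
  edge, which adds one for each neighbour of \<open>w\<close>, contributes at most the maximum
  degree.\<close>

lemma close_step_bound:
  assumes "few_open N g"
  shows "L2_set (close_step g) states \<le> sqrt (real (max_degree n E + 2 * N)) * L2_set g states"
proof -
  have "(\<Sum>s\<in>states. (close_step g s)\<^sup>2)
      \<le> (\<Sum>v<n. \<Sum>S\<in>Pow E. \<Sum>w\<in>nbh S v. real (card (nbh S v)) * (g (w, S - {{v, w}}))\<^sup>2)"
    unfolding sum_states close_step_def
    by (auto intro!: sum_mono order.trans[OF sum_squared_le_sum_of_squares]
        simp: sum_distrib_left mult.commute)
  also have "\<dots> \<le> (\<Sum>v<n. \<Sum>S\<in>Pow E. \<Sum>w\<in>nbh S v.
      real (card (nbh (S - {{v, w}}) v) + 1) * (g (w, S - {{v, w}}))\<^sup>2)"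
  proof (intro sum_mono mult_right_mono of_nat_mono)
    fix v S w
    have "nbh S v \<subseteq> insert w (nbh (S - {{v, w}}) v)"
      by (auto simp: nbh_def doubleton_eq_iff)
    then have "card (nbh S v) \<le> card (insert w (nbh (S - {{v, w}}) v))"
      by (intro card_mono) auto
    also have "\<dots> \<le> card (nbh (S - {{v, w}}) v) + 1" by (simp add: card_insert_if)
    finally show "card (nbh S v) \<le> card (nbh (S - {{v, w}}) v) + 1" .
  qed simp
  also have "\<dots> = (\<Sum>w<n. \<Sum>S\<in>Pow E. \<Sum>v\<in>nbh (E - S) w. real (card (nbh S v) + 1) * (g (w, S))\<^sup>2)"
    by (rule sum_transition[where F = "\<lambda>v w S. real (card (nbh S v) + 1) * (g (w, S))\<^sup>2"])
  also have "\<dots> \<le> (\<Sum>w<n. \<Sum>S\<in>Pow E. real (max_degree n E + 2 * N) * (g (w, S))\<^sup>2)"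
  proof (intro sum_mono)
    fix w S assume w: "w \<in> {..<n}" and S: "S \<in> Pow E"
    show "(\<Sum>v\<in>nbh (E - S) w. real (card (nbh S v) + 1) * (g (w, S))\<^sup>2)
        \<le> real (max_degree n E + 2 * N) * (g (w, S))\<^sup>2"
    proof (cases "card S > N")
      case True
      then show ?thesis using assms S by (simp add: few_open_def)
    next
      case False
      have "(\<Sum>v\<in>nbh (E - S) w. card (nbh S v) + 1)
          = (\<Sum>v\<in>nbh (E - S) w. card (nbh S v)) + card (nbh (E - S) w)"
        by (simp only: sum.distrib) simp
      also have "\<dots> \<le> (\<Sum>v<n. card (nbh S v)) + card (nbh E w)"
        by (intro add_mono sum_mono2 card_mono) (auto simp: nbh_def)
      also have "\<dots> \<le> 2 * N + max_degree n E"
        using sum_card_nbh_le[of S] card_nbh_le[of w] S w False by simp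
      finally show ?thesis
        unfolding sum_distrib_right[symmetric] of_nat_sum[symmetric]
        by (intro mult_right_mono of_nat_mono) auto
    qed
  qed
  also have "\<dots> = real (max_degree n E + 2 * N) * (\<Sum>s\<in>states. (g s)\<^sup>2)"
    unfolding sum_states by (simp add: sum_distrib_left)
  finally show ?thesis
    unfolding L2_set_def by (simp only: real_sqrt_mult[symmetric] real_sqrt_le_iff)
qed

lemma few_open_open_step:
  assumes "few_open N g"
  shows "few_open N (open_step g)"
  unfolding few_open_def
proof (intro allI impI)
  fix v S assume S: "S \<subseteq> E" "card S > N"
  have fin: "finite S" using S finite_E finite_subset by blast
  have "g (w, insert {v, w} S) = 0" if "w \<in> nbh (E - S) v" for w
  proof -
    have "{v, w} \<in> E" "{v, w} \<notin> S" using that by (auto simp: nbh_def)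
    then have "insert {v, w} S \<subseteq> E" "card (insert {v, w} S) > N" using S fin by auto
    then show ?thesis using assms by (simp add: few_open_def)
  qed
  then show "open_step g (v, S) = 0" by (simp add: open_step_def)
qed

lemma few_open_keep_step: "few_open N g \<Longrightarrow> few_open N (keep_step g)"
  by (auto simp: few_open_def keep_step_def)

text \<open>Closing evaluates \<open>g\<close> at a set with one edge fewer, so the support may grow
  by one edge. The other two operators keep the cutoff.\<close>

lemma few_open_close_step:
  assumes "few_open N g"
  shows "few_open (Suc N) (close_step g)"
  unfolding few_open_def
proof (intro allI impI)
  fix v S assume S: "S \<subseteq> E" "card S > Suc N"
  have fin: "finite S" using S finite_E finite_subset by blast
  have "g (w, S - {{v, w}}) = 0" if "w \<in> nbh S v" for w
  proof -
    have "{v, w} \<in> S" using that by (auto simp: nbh_def)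
    then have "S - {{v, w}} \<subseteq> E" "card (S - {{v, w}}) > N" using S fin by auto
    then show ?thesis using assms by (simp add: few_open_def)
  qed
  then show "close_step g (v, S) = 0" by (simp add: close_step_def)
qed

text \<open>An operator and its adjoint have the same norm: write the squared norm of
  \<open>open_step g\<close> as an inner product, move one factor over by adjointness, and apply the
  bound for closing. Opening preserves the cutoff \<open>N\<close>, so the constant is the
  same.\<close>

lemma open_step_bound:
  assumes "few_open N g"
  shows "L2_set (open_step g) states \<le> sqrt (real (max_degree n E + 2 * N)) * L2_set g states"
proof -
  let ?h = "open_step g" and ?c = "sqrt (real (max_degree n E + 2 * N))"
  have "(L2_set ?h states)\<^sup>2 = (\<Sum>s\<in>states. ?h s * open_step g s)"
    by (simp add: L2_set_def sum_nonneg power2_eq_square)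
  also have "\<dots> = (\<Sum>s\<in>states. close_step ?h s * g s)"
    by (rule close_open_adjoint[symmetric])
  also have "\<dots> \<le> (\<Sum>s\<in>states. \<bar>close_step ?h s\<bar> * \<bar>g s\<bar>)"
    by (intro sum_mono) (metis abs_ge_self abs_mult)
  also have "\<dots> \<le> L2_set (close_step ?h) states * L2_set g states"
    by (rule L2_set_mult_ineq)
  also have "\<dots> \<le> (?c * L2_set ?h states) * L2_set g states"
    by (intro mult_right_mono close_step_bound few_open_open_step assms L2_set_nonneg)
  finally have *: "L2_set ?h states * L2_set ?h states \<le> L2_set ?h states * (?c * L2_set g states)"
    by (simp add: power2_eq_square mult_ac)
  show ?thesis
  proof (cases "L2_set ?h states = 0")
    case True
    then show ?thesis by (simp add: L2_set_nonneg)
  next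
    case False
    then have "L2_set ?h states > 0" using L2_set_nonneg[of ?h states] by linarith
    then show ?thesis using * by (simp add: mult_le_cancel_left_pos)
  qed
qed

text \<open>As \<open>S\<close> does not change, the operator splits into the adjacency operators of
  the subgraphs \<open>S\<close>. The squared Frobenius norm of each is its number of ordered
  adjacent pairs, at most \<open>2 * N\<close>.\<close>

lemma keep_step_bound:
  assumes "few_open N g"
  shows "L2_set (keep_step g) states \<le> sqrt (real (2 * N)) * L2_set g states"
proof -
  have "(\<Sum>s\<in>states. (keep_step g s)\<^sup>2)
      \<le> (\<Sum>v<n. \<Sum>S\<in>Pow E. real (card (nbh S v)) * (\<Sum>w\<in>nbh S v. (g (w, S))\<^sup>2))"
    unfolding sum_states keep_step_def
    by (auto intro!: sum_mono order.trans[OF sum_squared_le_sum_of_squares] simp: mult.commute)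
  also have "\<dots> \<le> (\<Sum>v<n. \<Sum>S\<in>Pow E. real (card (nbh S v)) * (\<Sum>w<n. (g (w, S))\<^sup>2))"
    by (intro sum_mono mult_left_mono sum_mono2) (auto simp: nbh_def)
  also have "\<dots> = (\<Sum>S\<in>Pow E. real (\<Sum>v<n. card (nbh S v)) * (\<Sum>w<n. (g (w, S))\<^sup>2))"
    by (subst sum.swap) (simp add: sum_distrib_right)
  also have "\<dots> \<le> (\<Sum>S\<in>Pow E. real (2 * N) * (\<Sum>w<n. (g (w, S))\<^sup>2))"
  proof (intro sum_mono)
    fix S assume S: "S \<in> Pow E"
    show "real (\<Sum>v<n. card (nbh S v)) * (\<Sum>w<n. (g (w, S))\<^sup>2)
        \<le> real (2 * N) * (\<Sum>w<n. (g (w, S))\<^sup>2)"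
    proof (cases "card S > N")
      case True
      then show ?thesis using assms S by (simp add: few_open_def)
    next
      case False
      then show ?thesis using sum_card_nbh_le[of S] S
        by (intro mult_right_mono of_nat_mono sum_nonneg) auto
    qed
  qed
  also have "\<dots> = real (2 * N) * (\<Sum>s\<in>states. (g s)\<^sup>2)"
    unfolding sum_states by (subst sum.swap) (simp add: sum_distrib_left)
  finally show ?thesis
    unfolding L2_set_def by (simp only: real_sqrt_mult[symmetric] real_sqrt_le_iff)
qed

section \<open>Counting paths of states\<close>

text \<open>For \<open>s\<close> in \<open>states\<close>, this counts the paths of \<open>m\<close>
  steps through the states from \<open>s\<close> to \<open>(u, {})\<close>, that is, to the vertex
  \<open>u\<close> with no edge left open.\<close>

fun completions :: "nat \<Rightarrow> nat \<Rightarrow> nat \<times> nat set set \<Rightarrow> real" where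
  "completions u 0 s = of_bool (s = (u, {}))"
| "completions u (Suc m) s =
     close_step (completions u m) s + open_step (completions u m) s + keep_step (completions u m) s"

lemma few_open_completions: "few_open m (completions u m)"
proof (induction m)
  case 0
  then show ?case by (auto simp: few_open_def)
next
  case (Suc m)
  have "few_open (Suc m) h" if "few_open m h" for h
    using that by (auto simp: few_open_def)
  then have "few_open (Suc m) (open_step (completions u m))" "few_open (Suc m) (keep_step (completions u m))"
    by (auto intro: Suc few_open_open_step few_open_keep_step)
  then show ?case
    using few_open_close_step[OF Suc] by (simp add: few_open_def)
qed

text \<open>The cutoff \<open>N\<close> stays fixed while \<open>m\<close> grows, so that every step
  has the same constant; after \<open>m\<close> steps at most \<open>m\<close> \<le>
  \<open>N\<close> edges are open.\<close>

lemma L2_completions_le: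
  assumes "m \<le> N"
  shows "L2_set (completions u m) states
    \<le> (2 * sqrt (real (max_degree n E + 2 * N)) + sqrt (real (2 * N))) ^ m"
  using assms
proof (induction m)
  case 0
  have "(\<Sum>s\<in>states. (completions u 0 s)\<^sup>2) = (\<Sum>s\<in>states. if s = (u, {}) then 1 else 0)"
    by (intro sum.cong) auto
  also have "\<dots> \<le> 1" using finite_states by simp
  finally show ?case by (simp add: L2_set_def)
next
  case (Suc m)
  let ?c = "completions u m"
  have few: "few_open N ?c"
    using few_open_completions[of m u] Suc.prems by (auto simp: few_open_def)
  have "L2_set (completions u (Suc m)) states
      \<le> L2_set (\<lambda>s. close_step ?c s + open_step ?c s) states + L2_set (keep_step ?c) states"
    unfolding completions.simps by (rule L2_set_triangle_ineq)
  also have "\<dots> \<le> L2_set (close_step ?c) states + L2_set (open_step ?c) states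
      + L2_set (keep_step ?c) states"
    by (intro add_right_mono L2_set_triangle_ineq)
  also have "\<dots> \<le> (2 * sqrt (real (max_degree n E + 2 * N)) + sqrt (real (2 * N))) * L2_set ?c states"
    using close_step_bound[OF few] open_step_bound[OF few] keep_step_bound[OF few]
    by (simp add: algebra_simps)
  also have "\<dots> \<le> (2 * sqrt (real (max_degree n E + 2 * N)) + sqrt (real (2 * N)))
      * (2 * sqrt (real (max_degree n E + 2 * N)) + sqrt (real (2 * N))) ^ m"
    using Suc by (intro mult_left_mono) auto
  finally show ?case by (simp only: power_Suc)
qed

lemma completions_le:
  assumes "v < n"
  shows "completions u m (v, {})
    \<le> (2 * sqrt (real (max_degree n E + 2 * m)) + sqrt (real (2 * m))) ^ m"
proof -
  have "completions u m (v, {}) \<le> L2_set (completions u m) states"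
    by (rule member_le_L2_set) (auto simp: finite_states, simp add: states_def assms)
  then show ?thesis using L2_completions_le[of m m u] by simp
qed

end

section \<open>Spectral norm and trace moments\<close>

text \<open>Matrices act here on plain functions, so that powers are iterates and no dimensions have
  to be carried along.\<close>

definition mat_op :: "nat \<Rightarrow> (nat \<Rightarrow> nat \<Rightarrow> real) \<Rightarrow> (nat \<Rightarrow> real) \<Rightarrow> nat \<Rightarrow> real" where
  "mat_op N X f i = (\<Sum>j<N. X i j * f j)"

definition dot :: "nat \<Rightarrow> (nat \<Rightarrow> real) \<Rightarrow> (nat \<Rightarrow> real) \<Rightarrow> real" where
  "dot N f g = (\<Sum>i<N. f i * g i)"

definition unit_fun :: "nat \<Rightarrow> nat \<Rightarrow> real" where
  "unit_fun b i = of_bool (i = b)"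

lemma dot_self: "dot N f f = (\<Sum>i<N. (f i)\<^sup>2)"
  by (simp add: dot_def power2_eq_square)

lemma dot_self_nonneg [simp]: "0 \<le> dot N f f"
  by (simp add: dot_self sum_nonneg)

lemma dot_cauchy_schwarz: "(dot N f g)\<^sup>2 \<le> dot N f f * dot N g g"
  unfolding dot_self unfolding dot_def by (rule Cauchy_Schwarz_ineq_sum)

lemma dot_mat_op:
  assumes "\<And>i j. i < N \<Longrightarrow> j < N \<Longrightarrow> X i j = X j i"
  shows "dot N (mat_op N X f) g = dot N f (mat_op N X g)"
proof -
  have "dot N (mat_op N X f) g = (\<Sum>i<N. \<Sum>j<N. X i j * f j * g i)"
    by (simp add: dot_def mat_op_def sum_distrib_right)
  also have "\<dots> = (\<Sum>j<N. \<Sum>i<N. X i j * f j * g i)"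
    by (rule sum.swap)
  also have "\<dots> = (\<Sum>j<N. \<Sum>i<N. X j i * f j * g i)"
    using assms by (intro sum.cong refl) simp
  also have "\<dots> = dot N f (mat_op N X g)"
    by (simp add: dot_def mat_op_def sum_distrib_left mult_ac)
  finally show ?thesis .
qed

lemma dot_mat_op_funpow:
  assumes "\<And>i j. i < N \<Longrightarrow> j < N \<Longrightarrow> X i j = X j i"
  shows "dot N ((mat_op N X ^^ m) f) ((mat_op N X ^^ l) g) = dot N f ((mat_op N X ^^ (m + l)) g)"
proof (induction m arbitrary: l)
  case (Suc m)
  have "dot N ((mat_op N X ^^ Suc m) f) ((mat_op N X ^^ l) g)
      = dot N ((mat_op N X ^^ m) f) ((mat_op N X ^^ Suc l) g)"
    using dot_mat_op[OF assms] by simp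
  then show ?case using Suc[of "Suc l"] by simp
qed simp

text \<open>The ratios \<open>a (Suc m) / a m\<close> do not decrease, hence all are at least
  \<open>a 1 / a 0\<close>, which is at least \<open>a 1\<close>.\<close>

lemma log_convex_power_le:
  fixes a :: "nat \<Rightarrow> real"
  assumes nonneg: "\<And>m. 0 \<le> a m" and le1: "a 0 \<le> 1"
    and conv: "\<And>m. (a (Suc m))\<^sup>2 \<le> a m * a (Suc (Suc m))" and "p > 0"
  shows "a 1 ^ p \<le> a p"
proof (cases "a 1 = 0")
  case True
  then show ?thesis using \<open>p > 0\<close> nonneg by (simp add: power_0_left)
next
  case False
  then have pos1: "a 1 > 0" using nonneg[of 1] by linarith
  \<comment> \<open>Positivity is part of the induction because \<open>a m\<close> has to be
    cancelled.\<close>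
  have "a m > 0 \<and> a 1 * a m \<le> a (Suc m)" for m
  proof (induction m)
    case 0
    have "a 0 \<noteq> 0" using conv[of 0] pos1 by auto
    then have "a 0 > 0" using nonneg[of 0] by linarith
    then show ?case using le1 pos1 by (simp add: mult_left_le)
  next
    case (Suc m)
    have pos: "a (Suc m) > 0" using Suc pos1 by (meson less_le_trans mult_pos_pos)
    have "a m * (a 1 * a (Suc m)) = (a 1 * a m) * a (Suc m)" by simp
    also have "\<dots> \<le> a (Suc m) * a (Suc m)"
      using Suc pos by (intro mult_right_mono) auto
    also have "\<dots> \<le> a m * a (Suc (Suc m))"
      using conv[of m] by (simp add: power2_eq_square)
    finally show ?case using Suc pos by (simp add: mult_le_cancel_left_pos)
  qed
  note step = this
  obtain q where q: "p = Suc q" using \<open>p > 0\<close> gr0_implies_Suc by blast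
  have "a 1 ^ Suc q \<le> a (Suc q)"
  proof (induction q)
    case (Suc q)
    have "a 1 ^ Suc (Suc q) \<le> a 1 * a (Suc q)"
      using Suc pos1 by simp
    also have "\<dots> \<le> a (Suc (Suc q))" using step by blast
    finally show ?case .
  qed simp
  then show ?thesis using q by simp
qed

text \<open>This stands in for the spectral theorem: the squared norms of the iterates of a
  symmetric operator are log-convex, by Cauchy-Schwarz after moving one factor across the inner
  product.\<close>

lemma dot_mat_op_power_le:
  assumes sym: "\<And>i j. i < N \<Longrightarrow> j < N \<Longrightarrow> X i j = X j i"
    and "dot N f f \<le> 1" and "p > 0"
  shows "dot N (mat_op N X f) (mat_op N X f) ^ p
    \<le> dot N ((mat_op N X ^^ p) f) ((mat_op N X ^^ p) f)"
proof -
  define a where "a m = dot N ((mat_op N X ^^ m) f) ((mat_op N X ^^ m) f)" for m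
  have "a 1 ^ p \<le> a p"
  proof (rule log_convex_power_le)
    fix m
    have "a (Suc m) = dot N ((mat_op N X ^^ m) f) ((mat_op N X ^^ Suc (Suc m)) f)"
      using dot_mat_op[OF sym] by (simp add: a_def)
    then show "(a (Suc m))\<^sup>2 \<le> a m * a (Suc (Suc m))"
      using dot_cauchy_schwarz by (simp only: a_def)
  qed (use assms in \<open>auto simp: a_def\<close>)
  then show ?thesis by (simp add: a_def)
qed

section \<open>The trace of an even power bounds the norm\<close>

lemma mat_op_funpow_Suc:
  "(mat_op N X ^^ Suc m) f i = (\<Sum>j<N. X i j * (mat_op N X ^^ m) f j)"
  by (simp add: mat_op_def)

lemma mat_op_funpow_expand:
  "i < N \<Longrightarrow> (mat_op N X ^^ m) f i = (\<Sum>b<N. f b * (mat_op N X ^^ m) (unit_fun b) i)"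
proof (induction m arbitrary: i)
  case 0
  then show ?case by (simp add: unit_fun_def of_bool_def if_distrib cong: if_cong)
next
  case (Suc m)
  have "(mat_op N X ^^ Suc m) f i
      = (\<Sum>j<N. X i j * (\<Sum>b<N. f b * (mat_op N X ^^ m) (unit_fun b) j))"
    unfolding mat_op_funpow_Suc using Suc.IH by (intro sum.cong refl) simp
  also have "\<dots> = (\<Sum>j<N. \<Sum>b<N. f b * (X i j * (mat_op N X ^^ m) (unit_fun b) j))"
    by (simp add: sum_distrib_left mult_ac)
  also have "\<dots> = (\<Sum>b<N. \<Sum>j<N. f b * (X i j * (mat_op N X ^^ m) (unit_fun b) j))"
    by (rule sum.swap)
  finally show ?case by (simp only: mat_op_funpow_Suc sum_distrib_left)
qed

text \<open>The squared norm of the \<open>p\<close>-th iterate of \<open>f\<close> is at most the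
  squared Frobenius norm of the \<open>p\<close>-th power, which for symmetric \<open>X\<close> is
  the trace of the power \<open>2 * p\<close>.\<close>

lemma dot_mat_op_power_le_trace:
  assumes sym: "\<And>i j. i < N \<Longrightarrow> j < N \<Longrightarrow> X i j = X j i"
    and "dot N f f \<le> 1" and "p > 0"
  shows "dot N (mat_op N X f) (mat_op N X f) ^ p
    \<le> (\<Sum>b<N. (mat_op N X ^^ (2 * p)) (unit_fun b) b)"
proof -
  let ?A = "mat_op N X ^^ p"
  have "dot N (?A f) (?A f) \<le> (\<Sum>i<N. \<Sum>b<N. (?A (unit_fun b) i)\<^sup>2)"
    unfolding dot_self
  proof (rule sum_mono)
    fix i assume i: "i \<in> {..<N}"
    have "(?A f i)\<^sup>2 = (\<Sum>b<N. f b * ?A (unit_fun b) i)\<^sup>2"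
      using mat_op_funpow_expand[of i N p X f] i by simp
    also have "\<dots> \<le> (\<Sum>b<N. (f b)\<^sup>2) * (\<Sum>b<N. (?A (unit_fun b) i)\<^sup>2)"
      by (rule Cauchy_Schwarz_ineq_sum)
    also have "\<dots> \<le> 1 * (\<Sum>b<N. (?A (unit_fun b) i)\<^sup>2)"
      using assms(2) by (intro mult_right_mono) (auto simp: dot_self sum_nonneg)
    finally show "(?A f i)\<^sup>2 \<le> (\<Sum>b<N. (?A (unit_fun b) i)\<^sup>2)" by simp
  qed
  also have "\<dots> = (\<Sum>b<N. dot N (?A (unit_fun b)) (?A (unit_fun b)))"
    unfolding dot_self by (rule sum.swap)
  also have "\<dots> = (\<Sum>b<N. dot N (unit_fun b) ((mat_op N X ^^ (2 * p)) (unit_fun b)))"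
    by (subst dot_mat_op_funpow[OF sym]) (simp_all add: mult_2)
  also have "\<dots> = (\<Sum>b<N. (mat_op N X ^^ (2 * p)) (unit_fun b) b)"
    by (intro sum.cong refl) (simp add: dot_def unit_fun_def of_bool_def if_distrib[of "\<lambda>x. x * _"] cong: if_cong)
  finally show ?thesis using dot_mat_op_power_le[of N X f p, OF sym assms(2,3)] by linarith
qed

lemma spectral_norm_le_root_trace:
  assumes "M \<in> carrier_mat N N"
    and M: "\<And>i j. i < N \<Longrightarrow> j < N \<Longrightarrow> M $$ (i, j) = X i j"
    and sym: "\<And>i j. i < N \<Longrightarrow> j < N \<Longrightarrow> X i j = X j i"
    and "p > 0"
  shows "spectral_norm M \<le> root (2 * p) (\<Sum>b<N. (mat_op N X ^^ (2 * p)) (unit_fun b) b)"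
  unfolding spectral_norm_def
proof (rule cSUP_least)
  \<comment> \<open>The zero vector witnesses that the supremum runs over a nonempty set.\<close>
  have "0\<^sub>v N \<in> {x \<in> carrier_vec (dim_col M). euclidean_norm x \<le> 1}"
    using assms(1) by (simp add: euclidean_norm_def)
  then show "{x \<in> carrier_vec (dim_col M). euclidean_norm x \<le> 1} \<noteq> {}" by blast
next
  fix x assume "x \<in> {x \<in> carrier_vec (dim_col M). euclidean_norm x \<le> 1}"
  then have x: "x \<in> carrier_vec N" "euclidean_norm x \<le> 1" using assms(1) by auto
  let ?f = "\<lambda>i. x $ i"
  have sp: "y \<bullet> y = dot N (\<lambda>i. y $ i) (\<lambda>i. y $ i)" if "y \<in> carrier_vec N" for y :: "real Matrix.vec"
    using that by (simp add: scalar_prod_def dot_def lessThan_atLeast0)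
  have Mx: "(M *\<^sub>v x) $ i = mat_op N X ?f i" if "i < N" for i
    using that assms(1) x M by (simp add: scalar_prod_def mat_op_def lessThan_atLeast0)
  have le1: "dot N ?f ?f \<le> 1" using x sp[of x] by (simp add: euclidean_norm_def)
  have "(M *\<^sub>v x) \<bullet> (M *\<^sub>v x) = dot N (mat_op N X ?f) (mat_op N X ?f)"
    using assms(1) x by (subst sp) (auto simp: dot_def Mx simp del: index_mult_mat_vec)
  then have "euclidean_norm (M *\<^sub>v x) ^ (2 * p) = dot N (mat_op N X ?f) (mat_op N X ?f) ^ p"
    by (simp add: euclidean_norm_def power_mult)
  also have "\<dots> \<le> (\<Sum>b<N. (mat_op N X ^^ (2 * p)) (unit_fun b) b)"
    by (rule dot_mat_op_power_le_trace[OF sym le1 \<open>p > 0\<close>])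
  finally have le: "euclidean_norm (M *\<^sub>v x) ^ (2 * p) \<le> (\<Sum>b<N. (mat_op N X ^^ (2 * p)) (unit_fun b) b)" .
  have "0 \<le> (M *\<^sub>v x) \<bullet> (M *\<^sub>v x)"
    using \<open>(M *\<^sub>v x) \<bullet> (M *\<^sub>v x) = dot N (mat_op N X ?f) (mat_op N X ?f)\<close> by simp
  then have "euclidean_norm (M *\<^sub>v x) = root (2 * p) (euclidean_norm (M *\<^sub>v x) ^ (2 * p))"
    using \<open>p > 0\<close> by (simp add: euclidean_norm_def real_root_power_cancel)
  also have "\<dots> \<le> root (2 * p) (\<Sum>b<N. (mat_op N X ^^ (2 * p)) (unit_fun b) b)"
    using le \<open>p > 0\<close> by (intro real_root_le_mono) auto
  finally show "euclidean_norm (M *\<^sub>v x) \<le> root (2 * p) (\<Sum>b<N. (mat_op N X ^^ (2 * p)) (unit_fun b) b)" .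
qed

text \<open>Follows from Bernoulli's inequality, applied to the numbers \<open>root q (T s) / L\<close>.\<close>

lemma average_root_le:
  fixes T :: "'s \<Rightarrow> real"
  assumes fin: "finite A" and "A \<noteq> {}" and T: "\<And>s. s \<in> A \<Longrightarrow> 0 \<le> T s" and "q > 0" "L > 0"
    and avg: "(\<Sum>s\<in>A. T s) \<le> real (card A) * L ^ q"
  shows "(\<Sum>s\<in>A. root q (T s)) / real (card A) \<le> L"
proof -
  have card: "real (card A) > 0" using assms by (simp add: card_gt_0_iff)
  \<comment> \<open>The right side is the tangent of the concave function \<open>root q\<close> at
    \<open>L ^ q\<close>. It is affine in \<open>T s\<close>, so only the average of
    \<open>T\<close> matters.\<close>
  have "root q (T s) \<le> L * (1 - 1 / real q) + L / (real q * L ^ q) * T s" if "s \<in> A" for s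
  proof -
    define y where "y = root q (T s) / L"
    have y: "0 \<le> y" using T[OF that] \<open>L > 0\<close> \<open>q > 0\<close> by (simp add: y_def real_root_ge_zero)
    have "1 + real q * (y - 1) \<le> (1 + (y - 1)) ^ q"
      using y by (intro Bernoulli_inequality) auto
    also have "\<dots> = T s / L ^ q"
      using T[OF that] \<open>q > 0\<close> by (simp add: y_def power_divide)
    finally have "y \<le> (1 - 1 / real q) + T s / L ^ q / real q"
      using \<open>q > 0\<close> by (simp add: field_simps)
    then have "L * y \<le> L * ((1 - 1 / real q) + T s / L ^ q / real q)"
      using \<open>L > 0\<close> by (intro mult_left_mono) auto
    then show ?thesis using \<open>L > 0\<close> by (simp add: y_def algebra_simps)
  qed
  then have "(\<Sum>s\<in>A. root q (T s)) \<le> (\<Sum>s\<in>A. L * (1 - 1 / real q) + L / (real q * L ^ q) * T s)"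
    by (rule sum_mono)
  also have "\<dots> = real (card A) * (L * (1 - 1 / real q)) + L / (real q * L ^ q) * (\<Sum>s\<in>A. T s)"
    by (simp add: sum.distrib sum_distrib_left)
  also have "\<dots> \<le> real (card A) * (L * (1 - 1 / real q))
      + L / (real q * L ^ q) * (real (card A) * L ^ q)"
    using avg \<open>L > 0\<close> by (intro add_left_mono mult_left_mono) auto
  also have "\<dots> = real (card A) * L"
    using \<open>L > 0\<close> \<open>q > 0\<close> by (simp add: field_simps)
  finally show ?thesis using card by (simp add: field_simps)
qed

section \<open>Trace moments of centered lifts\<close>

lemma sum_lessThan_mult:
  fixes g :: "nat \<Rightarrow> real"
  shows "(\<Sum>i<n * k. g i) = (\<Sum>v<n. \<Sum>a<k. g (v * k + a))"
proof -
  have "(\<Sum>a<k. g (v * k + a)) = sum g {v * k..<v * k + k}" for v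
    using sum.shift_bounds_nat_ivl[of g 0 "v * k" k] by (simp add: lessThan_atLeast0 add.commute)
  then show ?thesis by (simp add: sum.nat_group)
qed

text \<open>Independence in finite form: if resampling the coordinate \<open>e\<close> averages
  \<open>g\<close> to zero whatever the other coordinates are, the whole sum vanishes.\<close>

lemma sum_PiE_dflt_eq_0:
  fixes g :: "('a \<Rightarrow> 's) \<Rightarrow> real"
  assumes "finite A" "finite P" "P \<noteq> {}" "e \<in> A"
    and zero: "\<And>f. f \<in> PiE_dflt A d (\<lambda>_. P) \<Longrightarrow> (\<Sum>s\<in>P. g (f(e := s))) = 0"
  shows "(\<Sum>f\<in>PiE_dflt A d (\<lambda>_. P). g f) = 0"
proof -
  let ?D = "PiE_dflt A d (\<lambda>_. P)" and ?\<phi> = "\<lambda>(f, s). (f(e := s), f e)"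
  have fin: "finite ?D" using assms by (intro finite_PiE_dflt) auto
  have "0 = (\<Sum>f\<in>?D. \<Sum>s\<in>P. g (f(e := s)))" using zero by simp
  also have "\<dots> = (\<Sum>(f, s)\<in>?D \<times> P. g (f(e := s)))" by (rule sum.cartesian_product)
  \<comment> \<open>Swapping the old value at \<open>e\<close> with the fresh one is an involution
    of the index set.\<close>
  also have "\<dots> = (\<Sum>(f, s)\<in>?D \<times> P. g f)"
    by (rule sum.reindex_bij_witness[where i = ?\<phi> and j = ?\<phi>])
      (use \<open>e \<in> A\<close> in \<open>auto simp: PiE_dflt_def\<close>)
  also have "\<dots> = real (card P) * (\<Sum>f\<in>?D. g f)"
    by (simp add: sum.cartesian_product[symmetric] sum_distrib_left)
  finally show ?thesis using assms by (simp add: card_gt_0_iff)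
qed

section \<open>Closed walks that use every edge at least twice\<close>

context simple_finite_graph
begin

text \<open>A walk is its start together with the list of later vertices, so its length is that of
  the list. The steps are not yet required to lie in \<open>E\<close>.\<close>

fun walk_edges :: "nat \<Rightarrow> nat list \<Rightarrow> nat set list" where
  "walk_edges v [] = []"
| "walk_edges v (w # ws) = {v, w} # walk_edges w ws"

definition walks :: "nat \<Rightarrow> nat list set" where
  "walks m = {ws. set ws \<subseteq> {..<n} \<and> length ws = m}"

lemma sum_walks_0 [simp]: "(\<Sum>ws\<in>walks 0. f ws) = f []"
proof -
  have "walks 0 = {[]}" by (auto simp: walks_def)
  then show ?thesis by simp
qed

lemma sum_walks_Suc: "(\<Sum>ws\<in>walks (Suc m). f ws) = (\<Sum>w<n. \<Sum>ws\<in>walks m. f (w # ws))"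
proof -
  have "(\<Sum>ws\<in>walks (Suc m). f ws) = (\<Sum>(w, ws)\<in>{..<n} \<times> walks m. f (w # ws))"
    by (rule sum.reindex_bij_witness[where i = "\<lambda>(w, ws). w # ws" and j = "\<lambda>ws. (hd ws, tl ws)"])
      (auto simp: walks_def length_Suc_conv)
  then show ?thesis by (simp add: sum.cartesian_product)
qed

text \<open>With \<open>S = {}\<close> and \<open>v = u\<close> these are the closed walks from
  \<open>u\<close> through \<open>E\<close> that use each of their edges at least twice. For general
  \<open>S\<close>, the open edges have had an earlier use and need only one more, which makes the
  condition inductive along the walk.\<close>

definition completes :: "nat \<Rightarrow> nat \<Rightarrow> nat set set \<Rightarrow> nat list \<Rightarrow> bool" where
  "completes u v S ws \<longleftrightarrow> set (walk_edges v ws) \<subseteq> E \<and> last (v # ws) = u \<and>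
     S \<subseteq> set (walk_edges v ws) \<and>
     (\<forall>e\<in>set (walk_edges v ws) - S. count_list (walk_edges v ws) e \<ge> 2)"

text \<open>The open edge stays open if it occurs again in \<open>ws\<close> and is closed
  otherwise.\<close>

lemma completes_Cons_open:
  assumes "completes u v S (w # ws)" "{v, w} \<in> S"
  shows "completes u w S ws \<or> completes u w (S - {{v, w}}) ws"
proof -
  let ?W = "walk_edges w ws"
  have W: "set ?W \<subseteq> E" "last (w # ws) = u" "S \<subseteq> insert {v, w} (set ?W)"
    using assms(1) by (simp_all add: completes_def)
  have "count_list ?W e \<ge> 2" if "e \<in> set ?W - S" for e
  proof -
    have "e \<noteq> {v, w}" using that assms(2) by blast
    moreover have "count_list (walk_edges v (w # ws)) e \<ge> 2"
      using that assms(1) unfolding completes_def by simp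
    ultimately show ?thesis by simp
  qed
  then show ?thesis
    using W unfolding completes_def by (cases "{v, w} \<in> set ?W") blast+
qed

text \<open>The first of at least two uses leaves another one for later, so the edge becomes
  open.\<close>

lemma completes_Cons_new:
  assumes "completes u v S (w # ws)" "{v, w} \<notin> S"
  shows "completes u w (insert {v, w} S) ws"
proof -
  have "{v, w} \<in> set (walk_edges v (w # ws)) - S" using assms by simp
  then have "count_list (walk_edges v (w # ws)) {v, w} \<ge> 2"
    using assms unfolding completes_def by blast
  then have "count_list (walk_edges w ws) {v, w} \<ge> 1" by simp
  then have "{v, w} \<in> set (walk_edges w ws)"
    using count_notin by fastforce
  moreover have "count_list (walk_edges w ws) e \<ge> 2"
    if "e \<in> set (walk_edges w ws) - insert {v, w} S" for e
  proof -
    have "count_list (walk_edges v (w # ws)) e \<ge> 2"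
      using that assms(1) unfolding completes_def by simp
    moreover have "e \<noteq> {v, w}" using that by blast
    ultimately show ?thesis by simp
  qed
  moreover have "set (walk_edges w ws) \<subseteq> E" "last (w # ws) = u"
    "S \<subseteq> insert {v, w} (set (walk_edges w ws))"
    using assms(1) by (simp_all add: completes_def)
  ultimately show ?thesis unfolding completes_def by blast
qed

lemma completions_nonneg: "0 \<le> completions u m s"
  by (induction m arbitrary: s)
    (auto simp: close_step_def open_step_def keep_step_def split: prod.split intro!: add_nonneg_nonneg sum_nonneg)

lemma card_completes_le:
  assumes "S \<subseteq> E"
  shows "(\<Sum>ws\<in>walks m. of_bool (completes u v S ws)) \<le> completions u m (v, S)"
  using assms
proof (induction m arbitrary: v S)
  case 0
  then show ?case by (auto simp: completes_def)
next
  case (Suc m)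
  let ?c = "completions u m"
  have step: "(\<Sum>ws\<in>walks m. of_bool (completes u v S (w # ws)))
      \<le> (if {v, w} \<in> S then ?c (w, S - {{v, w}}) else 0)
        + (if {v, w} \<in> E - S then ?c (w, insert {v, w} S) else 0)
        + (if {v, w} \<in> S then ?c (w, S) else 0)" for w
  proof -
    consider "{v, w} \<in> S" | "{v, w} \<in> E - S" | "{v, w} \<notin> E" by blast
    then show ?thesis
    proof cases
      case 1
      have "(\<Sum>ws\<in>walks m. of_bool (completes u v S (w # ws)))
          \<le> (\<Sum>ws\<in>walks m. of_bool (completes u w (S - {{v, w}}) ws) + (of_bool (completes u w S ws) :: real))"
        by (intro sum_mono) (use completes_Cons_open[OF _ 1] in \<open>auto simp: of_bool_def\<close>)
      also have "\<dots> \<le> ?c (w, S - {{v, w}}) + ?c (w, S)"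
        unfolding sum.distrib using Suc.prems by (intro add_mono Suc.IH) auto
      finally show ?thesis using 1 by simp
    next
      case 2
      have "(\<Sum>ws\<in>walks m. of_bool (completes u v S (w # ws)))
          \<le> (\<Sum>ws\<in>walks m. (of_bool (completes u w (insert {v, w} S) ws) :: real))"
        by (intro sum_mono) (use completes_Cons_new 2 in \<open>auto simp: of_bool_def\<close>)
      also have "\<dots> \<le> ?c (w, insert {v, w} S)"
        using Suc 2 by (intro Suc.IH) auto
      finally show ?thesis using 2 by simp
    next
      case 3
      then have "\<not> completes u v S (w # ws)" for ws by (simp add: completes_def)
      then show ?thesis using completions_nonneg by simp
    qed
  qed
  have "(\<Sum>ws\<in>walks (Suc m). of_bool (completes u v S ws))
      = (\<Sum>w<n. \<Sum>ws\<in>walks m. (of_bool (completes u v S (w # ws)) :: real))"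
    by (rule sum_walks_Suc)
  also have "\<dots> \<le> (\<Sum>w<n. (if {v, w} \<in> S then ?c (w, S - {{v, w}}) else 0)
        + (if {v, w} \<in> E - S then ?c (w, insert {v, w} S) else 0)
        + (if {v, w} \<in> S then ?c (w, S) else 0))"
    by (intro sum_mono step)
  also have "\<dots> = completions u (Suc m) (v, S)"
    by (simp only: sum.distrib completions.simps close_step_def open_step_def keep_step_def sum_nbh prod.case)
  finally show ?case .
qed

end

section \<open>Random block matrices on a graph\<close>

text \<open>\<open>Y s v w\<close> is the \<open>k\<close> by \<open>k\<close> block at
  \<open>(v, w)\<close> when the edge has drawn \<open>s\<close> from \<open>P\<close>. The
  assumptions are what the moment method needs: mean zero, operator norm at most one, and symmetry
  of the full matrix. The value \<open>d\<close> fixes outcomes outside \<open>E\<close>, so that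
  the sample space is finite.\<close>

locale centered_lift = simple_finite_graph +
  fixes k :: nat and P :: "'s set" and d :: 's and Y :: "'s \<Rightarrow> nat \<Rightarrow> nat \<Rightarrow> nat \<Rightarrow> nat \<Rightarrow> real"
  assumes finite_P: "finite P" and P_nonempty: "P \<noteq> {}"
    and centered: "\<And>v w a b. \<lbrakk>{v, w} \<in> E; a < k; b < k\<rbrakk> \<Longrightarrow> (\<Sum>s\<in>P. Y s v w a b) = 0"
    and contraction: "\<And>s v w x. \<lbrakk>s \<in> P; {v, w} \<in> E\<rbrakk>
      \<Longrightarrow> (\<Sum>a<k. (\<Sum>b<k. Y s v w a b * x b)\<^sup>2) \<le> (\<Sum>b<k. (x b)\<^sup>2)"
    and Y_sym: "\<And>s v w a b. \<lbrakk>s \<in> P; {v, w} \<in> E; a < k; b < k\<rbrakk> \<Longrightarrow> Y s v w a b = Y s w v b a"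
begin

definition outcomes :: "(nat set \<Rightarrow> 's) set" where
  "outcomes = PiE_dflt E d (\<lambda>_. P)"

definition lift_entry :: "(nat set \<Rightarrow> 's) \<Rightarrow> nat \<Rightarrow> nat \<Rightarrow> real" where
  "lift_entry \<pi> i j = (if {i div k, j div k} \<in> E
     then Y (\<pi> {i div k, j div k}) (i div k) (j div k) (i mod k) (j mod k) else 0)"

lemma finite_outcomes: "finite outcomes"
  unfolding outcomes_def using finite_E finite_P by (intro finite_PiE_dflt) auto

lemma outcomes_nonempty: "outcomes \<noteq> {}"
proof -
  obtain s where "s \<in> P" using P_nonempty by blast
  then have "(\<lambda>e. if e \<in> E then s else d) \<in> outcomes" by (auto simp: outcomes_def PiE_dflt_def)
  then show ?thesis by blast
qed

lemma outcomes_mem: "\<pi> \<in> outcomes \<Longrightarrow> e \<in> E \<Longrightarrow> \<pi> e \<in> P"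
  by (simp add: outcomes_def PiE_dflt_def)

lemma lift_entry_sym:
  assumes "\<pi> \<in> outcomes" "i < n * k" "j < n * k"
  shows "lift_entry \<pi> i j = lift_entry \<pi> j i"
proof -
  have "k > 0" using assms by (cases k) auto
  then show ?thesis
    using Y_sym[of "\<pi> {i div k, j div k}" "i div k" "j div k" "i mod k" "j mod k"] outcomes_mem[OF assms(1)]
    by (auto simp: lift_entry_def insert_commute)
qed

text \<open>Entry \<open>a\<close> of the product of the blocks along the walk, applied to the block
  of \<open>f\<close> at its last vertex.\<close>

fun walk_val :: "(nat set \<Rightarrow> 's) \<Rightarrow> (nat \<Rightarrow> real) \<Rightarrow> nat \<Rightarrow> nat list \<Rightarrow> nat \<Rightarrow> real" where
  "walk_val \<pi> f v [] a = f (v * k + a)"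
| "walk_val \<pi> f v (w # ws) a =
     (if {v, w} \<in> E then \<Sum>b<k. Y (\<pi> {v, w}) v w a b * walk_val \<pi> f w ws b else 0)"

lemma mat_op_funpow_eq_sum_walks:
  assumes "v < n" "a < k"
  shows "(mat_op (n * k) (lift_entry \<pi>) ^^ m) f (v * k + a) = (\<Sum>ws\<in>walks m. walk_val \<pi> f v ws a)"
  using assms
proof (induction m arbitrary: v a)
  case (Suc m)
  have "(mat_op (n * k) (lift_entry \<pi>) ^^ Suc m) f (v * k + a)
      = (\<Sum>w<n. \<Sum>b<k. lift_entry \<pi> (v * k + a) (w * k + b) * (\<Sum>ws\<in>walks m. walk_val \<pi> f w ws b))"
    unfolding mat_op_funpow_Suc sum_lessThan_mult using Suc.IH by simp
  also have "\<dots> = (\<Sum>w<n. \<Sum>b<k. \<Sum>ws\<in>walks m.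
      (if {v, w} \<in> E then Y (\<pi> {v, w}) v w a b * walk_val \<pi> f w ws b else 0))"
    using Suc.prems by (auto intro!: sum.cong simp: lift_entry_def sum_distrib_left)
  also have "\<dots> = (\<Sum>w<n. \<Sum>ws\<in>walks m. \<Sum>b<k.
      (if {v, w} \<in> E then Y (\<pi> {v, w}) v w a b * walk_val \<pi> f w ws b else 0))"
    by (intro sum.cong refl sum.swap)
  also have "\<dots> = (\<Sum>ws\<in>walks (Suc m). walk_val \<pi> f v ws a)"
    unfolding sum_walks_Suc by (intro sum.cong refl) simp
  finally show ?case .
qed simp

lemma walk_val_contraction:
  assumes "\<pi> \<in> outcomes"
  shows "(\<Sum>a<k. (walk_val \<pi> f v ws a)\<^sup>2) \<le> (\<Sum>a<k. (f (last (v # ws) * k + a))\<^sup>2)"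
proof (induction ws arbitrary: v)
  case (Cons w ws)
  show ?case
  proof (cases "{v, w} \<in> E")
    case True
    then have "(\<Sum>a<k. (walk_val \<pi> f v (w # ws) a)\<^sup>2) \<le> (\<Sum>b<k. (walk_val \<pi> f w ws b)\<^sup>2)"
      using contraction[OF outcomes_mem[OF assms True] True] by simp
    then show ?thesis using Cons[of w] by simp
  next
    case False
    then show ?thesis by (simp add: sum_nonneg)
  qed
qed simp

lemma walk_val_power2_le:
  assumes "\<pi> \<in> outcomes" "b < k"
  shows "(walk_val \<pi> f v ws b)\<^sup>2 \<le> (\<Sum>a<k. (f (last (v # ws) * k + a))\<^sup>2)"
proof -
  have "(walk_val \<pi> f v ws b)\<^sup>2 \<le> (\<Sum>a<k. (walk_val \<pi> f v ws a)\<^sup>2)"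
    using assms(2) by (intro member_le_sum) auto
  then show ?thesis using walk_val_contraction[OF assms(1), of f v ws] by linarith
qed

lemma walk_val_eq_0: "\<not> set (walk_edges v ws) \<subseteq> E \<Longrightarrow> walk_val \<pi> f v ws a = 0"
  by (induction ws arbitrary: v a) auto

lemma walk_val_fun_upd:
  "e \<notin> set (walk_edges v ws) \<Longrightarrow> walk_val (\<pi>(e := s)) f v ws a = walk_val \<pi> f v ws a"
  by (induction ws arbitrary: v a) auto

text \<open>The product is linear in the only block that depends on the draw at \<open>e\<close>,
  and this block averages to zero.\<close>

lemma sum_walk_val_single_edge:
  assumes "count_list (walk_edges v ws) e = 1" "e \<in> E" "a < k"
  shows "(\<Sum>s\<in>P. walk_val (\<pi>(e := s)) f v ws a) = 0"
  using assms
proof (induction ws arbitrary: v a)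
  case (Cons w ws)
  show ?case
  proof (cases "{v, w} = e")
    case True
    then have "e \<notin> set (walk_edges w ws)" using Cons.prems by (simp add: count_list_0_iff)
    then have "(\<Sum>s\<in>P. walk_val (\<pi>(e := s)) f v (w # ws) a)
        = (\<Sum>s\<in>P. \<Sum>b<k. Y s v w a b * walk_val \<pi> f w ws b)"
      using True Cons.prems by (simp add: walk_val_fun_upd)
    also have "\<dots> = (\<Sum>b<k. (\<Sum>s\<in>P. Y s v w a b) * walk_val \<pi> f w ws b)"
      by (subst sum.swap) (simp add: sum_distrib_right)
    also have "\<dots> = 0" using True Cons.prems centered by simp
    finally show ?thesis .
  next
    case False
    then have c: "count_list (walk_edges w ws) e = 1" using Cons.prems by simp
    show ?thesis
    proof (cases "{v, w} \<in> E")
      case True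
      have "(\<Sum>s\<in>P. walk_val (\<pi>(e := s)) f v (w # ws) a)
          = (\<Sum>s\<in>P. \<Sum>b<k. Y (\<pi> {v, w}) v w a b * walk_val (\<pi>(e := s)) f w ws b)"
        using True False by simp
      also have "\<dots> = (\<Sum>b<k. Y (\<pi> {v, w}) v w a b * (\<Sum>s\<in>P. walk_val (\<pi>(e := s)) f w ws b))"
        by (subst sum.swap) (simp add: sum_distrib_left)
      also have "\<dots> = 0"
        by (intro sum.neutral ballI) (use Cons.IH[OF c] Cons.prems in \<open>simp del: fun_upd_apply\<close>)
      finally show ?thesis .
    qed simp
  qed
qed simp

text \<open>A product of contractions applied to a unit vector has entries at most one, so each walk
  costs at most one per outcome.\<close>

lemma sum_walk_val_le:
  assumes "c < k"
  shows "(\<Sum>\<pi>\<in>outcomes. walk_val \<pi> (unit_fun (u * k + c)) u ws c)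
    \<le> real (card outcomes) * of_bool (completes u u {} ws)"
proof (cases "completes u u {} ws")
  case True
  have "walk_val \<pi> (unit_fun (u * k + c)) u ws c \<le> 1" if "\<pi> \<in> outcomes" for \<pi>
  proof -
    have "(walk_val \<pi> (unit_fun (u * k + c)) u ws c)\<^sup>2
        \<le> (\<Sum>a<k. (unit_fun (u * k + c) (last (u # ws) * k + a))\<^sup>2)"
      by (rule walk_val_power2_le[OF that assms])
    also have "\<dots> = (\<Sum>a<k. if a = c then 1 else 0)"
      using True by (intro sum.cong refl) (auto simp: unit_fun_def completes_def)
    also have "\<dots> \<le> 1" using assms by simp
    finally show ?thesis by (simp add: power2_le_iff_abs_le abs_square_le_1)
  qed
  then have "(\<Sum>\<pi>\<in>outcomes. walk_val \<pi> (unit_fun (u * k + c)) u ws c) \<le> (\<Sum>\<pi>\<in>outcomes. 1)"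
    by (rule sum_mono)
  then show ?thesis using True by simp
next
  case False
  have "\<exists>e\<in>E. count_list (walk_edges u ws) e = 1"
    if "set (walk_edges u ws) \<subseteq> E" "last (u # ws) = u"
  proof -
    have "\<exists>e\<in>set (walk_edges u ws). \<not> count_list (walk_edges u ws) e \<ge> 2"
      using False that by (simp only: completes_def Diff_empty empty_subsetI simp_thms) simp
    then obtain e where e: "e \<in> set (walk_edges u ws)" "\<not> count_list (walk_edges u ws) e \<ge> 2"
      by (elim bexE)
    then have "count_list (walk_edges u ws) e \<noteq> 0" by (simp add: count_list_0_iff)
    then have "count_list (walk_edges u ws) e = 1" using e by linarith
    then show ?thesis using e(1) that(1) by (intro bexI[of _ e]) auto
  qed
  \<comment> \<open>The ways to fail: a step outside \<open>E\<close> makes the product zero, a walk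
    that is not closed misses the support of the unit vector, and an edge used exactly once averages
    out.\<close>
  then consider "\<not> set (walk_edges u ws) \<subseteq> E" | "last (u # ws) \<noteq> u"
    | e where "e \<in> E" "count_list (walk_edges u ws) e = 1"
    by metis
  then have "(\<Sum>\<pi>\<in>outcomes. walk_val \<pi> (unit_fun (u * k + c)) u ws c) = 0"
  proof cases
    case 1
    then show ?thesis by (simp add: walk_val_eq_0)
  next
    case 2
    have "(\<Sum>a<k. (unit_fun (u * k + c) (last (u # ws) * k + a))\<^sup>2) = 0"
    proof (intro sum.neutral ballI)
      fix a assume "a \<in> {..<k}"
      then have "(last (u # ws) * k + a) div k = last (u # ws)" "(u * k + c) div k = u"
        using assms by simp_all
      then have "last (u # ws) * k + a \<noteq> u * k + c" using 2 by metis
      then show "(unit_fun (u * k + c) (last (u # ws) * k + a))\<^sup>2 = 0" by (simp add: unit_fun_def)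
    qed
    then have "walk_val \<pi> (unit_fun (u * k + c)) u ws c = 0" if "\<pi> \<in> outcomes" for \<pi>
      using walk_val_power2_le[OF that assms, of "unit_fun (u * k + c)" u ws] by simp
    then show ?thesis by simp
  next
    case 3
    then show ?thesis unfolding outcomes_def
      using finite_E finite_P P_nonempty sum_walk_val_single_edge[OF 3(2,1) assms]
      by (intro sum_PiE_dflt_eq_0) auto
  qed
  then show ?thesis by simp
qed

lemma sum_trace_le:
  "(\<Sum>\<pi>\<in>outcomes. \<Sum>i<n * k. (mat_op (n * k) (lift_entry \<pi>) ^^ m) (unit_fun i) i)
    \<le> real (card outcomes) * (real (n * k) *
        (2 * sqrt (real (max_degree n E + 2 * m)) + sqrt (real (2 * m))) ^ m)"
proof -
  let ?L = "(2 * sqrt (real (max_degree n E + 2 * m)) + sqrt (real (2 * m))) ^ m"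
  have "(\<Sum>\<pi>\<in>outcomes. \<Sum>i<n * k. (mat_op (n * k) (lift_entry \<pi>) ^^ m) (unit_fun i) i)
      = (\<Sum>i<n * k. \<Sum>\<pi>\<in>outcomes. (mat_op (n * k) (lift_entry \<pi>) ^^ m) (unit_fun i) i)"
    by (rule sum.swap)
  also have "\<dots> = (\<Sum>v<n. \<Sum>a<k. \<Sum>\<pi>\<in>outcomes. \<Sum>ws\<in>walks m. walk_val \<pi> (unit_fun (v * k + a)) v ws a)"
    unfolding sum_lessThan_mult by (simp add: mat_op_funpow_eq_sum_walks)
  also have "\<dots> = (\<Sum>v<n. \<Sum>a<k. \<Sum>ws\<in>walks m. \<Sum>\<pi>\<in>outcomes. walk_val \<pi> (unit_fun (v * k + a)) v ws a)"
    by (intro sum.cong refl sum.swap)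
  also have "\<dots> \<le> (\<Sum>v<n. \<Sum>a<k. \<Sum>ws\<in>walks m. real (card outcomes) * of_bool (completes v v {} ws))"
    by (intro sum_mono sum_walk_val_le) simp
  also have "\<dots> = (\<Sum>v<n. \<Sum>a<k. real (card outcomes) * (\<Sum>ws\<in>walks m. of_bool (completes v v {} ws)))"
    by (simp only: sum_distrib_left)
  also have "\<dots> \<le> (\<Sum>v<n. \<Sum>a<k. real (card outcomes) * ?L)"
    by (intro sum_mono mult_left_mono order.trans[OF card_completes_le completions_le]) auto
  finally show ?thesis by (simp add: mult_ac)
qed

end

section \<open>From trace moments to the average norm\<close>

context centered_lift
begin

text \<open>The trace bound at the zero vector; nonnegativity is needed to average roots.\<close>

lemma trace_nonneg:
  assumes "\<pi> \<in> outcomes" "p > 0"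
  shows "0 \<le> (\<Sum>i<n * k. (mat_op (n * k) (lift_entry \<pi>) ^^ (2 * p)) (unit_fun i) i)"
proof -
  have "dot (n * k) (mat_op (n * k) (lift_entry \<pi>) (\<lambda>_. 0)) (mat_op (n * k) (lift_entry \<pi>) (\<lambda>_. 0)) ^ p
      \<le> (\<Sum>i<n * k. (mat_op (n * k) (lift_entry \<pi>) ^^ (2 * p)) (unit_fun i) i)"
    by (rule dot_mat_op_power_le_trace) (use lift_entry_sym[OF assms(1)] assms(2) in \<open>auto simp: dot_def\<close>)
  moreover have "0 \<le> dot (n * k) (mat_op (n * k) (lift_entry \<pi>) (\<lambda>_. 0)) (mat_op (n * k) (lift_entry \<pi>) (\<lambda>_. 0)) ^ p"
    by simp
  ultimately show ?thesis by linarith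
qed

text \<open>The root of order \<open>2 * p\<close> turns the dimension factor \<open>n * k\<close>
  of the trace into at most \<open>1 + \<epsilon>\<close>.\<close>

lemma average_root_trace_le:
  assumes "p > 0" "\<epsilon> > 0" "real (n * k) \<le> (1 + \<epsilon>) ^ (2 * p)"
  shows "(\<Sum>\<pi>\<in>outcomes. root (2 * p) (\<Sum>i<n * k. (mat_op (n * k) (lift_entry \<pi>) ^^ (2 * p)) (unit_fun i) i))
      / real (card outcomes)
    \<le> (1 + \<epsilon>) * (2 * sqrt (real (max_degree n E)) + 6 * sqrt (real p))"
proof -
  let ?\<Delta> = "real (max_degree n E)"
  define L where "L = 2 * sqrt (real (max_degree n E + 2 * (2 * p))) + sqrt (real (2 * (2 * p)))"
  have four: "sqrt (real (2 * (2 * p))) = 2 * sqrt (real p)"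
    using real_sqrt_mult[of 4 "real p"] by simp
  have L: "L > 0" using assms(1) by (simp add: L_def add_nonneg_pos)
  \<comment> \<open>Walks have length \<open>2 * p\<close>, so the cutoff term is
    \<open>4 * p\<close>, with root \<open>2 * sqrt p\<close>. It enters twice through opening and
    closing and once through keeping, which gives the 6.\<close>
  have "sqrt (real (max_degree n E + 2 * (2 * p))) \<le> sqrt ?\<Delta> + sqrt (real (2 * (2 * p)))"
    unfolding of_nat_add by (rule sqrt_add_le_add_sqrt) auto
  then have L_le: "L \<le> 2 * sqrt ?\<Delta> + 6 * sqrt (real p)"
    unfolding L_def four by linarith
  have "(\<Sum>\<pi>\<in>outcomes. root (2 * p) (\<Sum>i<n * k. (mat_op (n * k) (lift_entry \<pi>) ^^ (2 * p)) (unit_fun i) i))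
      / real (card outcomes) \<le> (1 + \<epsilon>) * L"
  proof (rule average_root_le)
    have "(\<Sum>\<pi>\<in>outcomes. \<Sum>i<n * k. (mat_op (n * k) (lift_entry \<pi>) ^^ (2 * p)) (unit_fun i) i)
        \<le> real (card outcomes) * (real (n * k) * L ^ (2 * p))"
      unfolding L_def by (rule sum_trace_le)
    also have "\<dots> \<le> real (card outcomes) * ((1 + \<epsilon>) ^ (2 * p) * L ^ (2 * p))"
      using assms(3) L by (intro mult_left_mono mult_right_mono) auto
    finally show "(\<Sum>\<pi>\<in>outcomes. \<Sum>i<n * k. (mat_op (n * k) (lift_entry \<pi>) ^^ (2 * p)) (unit_fun i) i)
        \<le> real (card outcomes) * ((1 + \<epsilon>) * L) ^ (2 * p)"
      by (simp only: power_mult_distrib)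
  qed (use finite_outcomes outcomes_nonempty trace_nonneg assms L in auto)
  also have "\<dots> \<le> (1 + \<epsilon>) * (2 * sqrt ?\<Delta> + 6 * sqrt (real p))"
    using L_le assms(2) by (intro mult_left_mono) auto
  finally show ?thesis .
qed

end

section \<open>Centered permutation blocks\<close>

text \<open>A permutation matrix minus its mean. The permutation of an edge is read from the smaller
  endpoint to the larger, hence the transpose in the other direction.\<close>

definition centered_perm_block :: "nat \<Rightarrow> (nat \<Rightarrow> nat) \<Rightarrow> nat \<Rightarrow> nat \<Rightarrow> nat \<Rightarrow> nat \<Rightarrow> real" where
  "centered_perm_block k s v w a b =
     (if v < w then of_bool (s a = b) else of_bool (s b = a)) - 1 / real k"

text \<open>Composing with the transposition of \<open>b\<close> and \<open>c\<close> exchanges the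
  permutations that send \<open>a\<close> to \<open>b\<close> with those that send it to
  \<open>c\<close>, so all \<open>k\<close> images are equally likely.\<close>

lemma sum_permutes_of_bool:
  assumes "a < k" "b < k"
  shows "(\<Sum>s\<in>{s. s permutes {..<k}}. of_bool (s a = b)) = real (card {s. s permutes {..<k}}) / real k"
proof -
  let ?P = "{s. s permutes {..<k}}"
  have eq: "(\<Sum>s\<in>?P. of_bool (s a = c)) = (\<Sum>s\<in>?P. (of_bool (s a = b) :: real))" if "c < k" for c
  proof (rule sum.reindex_bij_witness[where i = "\<lambda>s. Transposition.transpose b c \<circ> s"
        and j = "\<lambda>s. Transposition.transpose b c \<circ> s"])
    fix s assume s: "s \<in> ?P"
    show "Transposition.transpose b c \<circ> (Transposition.transpose b c \<circ> s) = s" by (simp add: fun_eq_iff)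
    then show "Transposition.transpose b c \<circ> (Transposition.transpose b c \<circ> s) = s" .
    have "Transposition.transpose b c permutes {..<k}"
      using assms that by (intro permutes_swap_id) auto
    then show "Transposition.transpose b c \<circ> s \<in> ?P" using s permutes_compose by blast
    then show "Transposition.transpose b c \<circ> s \<in> ?P" .
    show "of_bool ((Transposition.transpose b c \<circ> s) a = b) = (of_bool (s a = c) :: real)"
      by (auto simp: transpose_eq_iff transpose_def)
  qed
  have "real k * (\<Sum>s\<in>?P. of_bool (s a = b)) = (\<Sum>c<k. \<Sum>s\<in>?P. of_bool (s a = c))"
    using eq by simp
  also have "\<dots> = (\<Sum>s\<in>?P. \<Sum>c<k. of_bool (s a = c))"
    by (rule sum.swap)
  also have "\<dots> = (\<Sum>s\<in>?P. 1)"
  proof (rule sum.cong[OF refl])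
    fix s assume "s \<in> ?P"
    then have "s a < k" using permutes_in_image[of s "{..<k}" a] assms by simp
    then show "(\<Sum>c<k. of_bool (s a = c)) = (1::real)" by (simp add: of_bool_def)
  qed
  finally show ?thesis using assms by (simp add: field_simps)
qed

text \<open>Subtracting the mean is an orthogonal projection.\<close>

lemma sum_power2_centered_le:
  fixes x :: "nat \<Rightarrow> real"
  shows "(\<Sum>a<k. (x a - (\<Sum>b<k. x b) / real k)\<^sup>2) \<le> (\<Sum>a<k. (x a)\<^sup>2)"
proof -
  define m where "m = (\<Sum>b<k. x b) / real k"
  have m: "(\<Sum>b<k. x b) = real k * m" by (cases "k = 0") (simp_all add: m_def)
  have "(\<Sum>a<k. (x a - m)\<^sup>2) = (\<Sum>a<k. (x a)\<^sup>2 - 2 * m * x a + m\<^sup>2)"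
    by (simp add: power2_diff algebra_simps)
  also have "\<dots> = (\<Sum>a<k. (x a)\<^sup>2) - 2 * m * (\<Sum>a<k. x a) + real k * m\<^sup>2"
    by (simp add: sum.distrib sum_subtractf sum_distrib_left)
  also have "\<dots> = (\<Sum>a<k. (x a)\<^sup>2) - real k * m\<^sup>2"
    by (simp add: m power2_eq_square)
  finally show ?thesis by (simp add: m_def)
qed

lemma centered_perm_block_contraction:
  assumes "s permutes {..<k}"
  shows "(\<Sum>a<k. (\<Sum>b<k. centered_perm_block k s v w a b * x b)\<^sup>2) \<le> (\<Sum>b<k. (x b)\<^sup>2)"
proof -
  let ?m = "(\<Sum>b<k. x b) / real k"
  \<comment> \<open>In either direction the block is a permutation followed by centering;
    \<open>t\<close> is \<open>s\<close> or its inverse.\<close>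
  obtain t where t: "t permutes {..<k}"
    and Y: "\<And>a b. centered_perm_block k s v w a b = of_bool (b = t a) - 1 / real k"
  proof (cases "v < w")
    case True
    then show thesis using that[OF assms] by (auto simp: centered_perm_block_def eq_commute)
  next
    case False
    have "s b = a \<longleftrightarrow> b = inv_into UNIV s a" for a b
      using permutes_inverses[OF assms] by metis
    then show thesis
      using that[OF permutes_inv[OF assms]] False by (simp add: centered_perm_block_def)
  qed
  have "(\<Sum>b<k. centered_perm_block k s v w a b * x b) = x (t a) - ?m" if "a < k" for a
  proof -
    have "t a < k" using permutes_in_image[OF t, of a] that by simp
    have "(\<Sum>b<k. centered_perm_block k s v w a b * x b) = (\<Sum>b<k. (if b = t a then x b else 0) - x b / real k)"
      unfolding Y by (intro sum.cong) (auto simp: algebra_simps)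
    then show ?thesis using \<open>t a < k\<close> by (simp add: sum_subtractf sum_divide_distrib)
  qed
  then have "(\<Sum>a<k. (\<Sum>b<k. centered_perm_block k s v w a b * x b)\<^sup>2) = (\<Sum>a<k. (x (t a) - ?m)\<^sup>2)"
    by simp
  also have "\<dots> = (\<Sum>a<k. (x a - ?m)\<^sup>2)"
    using sum.permute[OF t, of "\<lambda>a. (x a - ?m)\<^sup>2"] by (simp add: o_def)
  also have "\<dots> \<le> (\<Sum>b<k. (x b)\<^sup>2)" by (rule sum_power2_centered_le)
  finally show ?thesis .
qed

lemma centered_lift_perm:
  assumes "simple_graph n E"
  shows "centered_lift n E k {s. s permutes {..<k}} (centered_perm_block k)"
proof -
  interpret simple_finite_graph n E by unfold_locales (rule assms)
  show ?thesis
  proof unfold_locales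
    show "finite {s. s permutes {..<k}}" by (simp add: finite_permutations)
    show "{s. s permutes {..<k}} \<noteq> {}" using permutes_id by blast
  next
    fix v w a b assume "a < k" "b < k"
    then show "(\<Sum>s\<in>{s. s permutes {..<k}}. centered_perm_block k s v w a b) = 0"
      using sum_permutes_of_bool
      by (cases "v < w") (simp_all add: centered_perm_block_def sum_subtractf)
  next
    fix s v w and x :: "nat \<Rightarrow> real" assume "s \<in> {s. s permutes {..<k}}"
    then show "(\<Sum>a<k. (\<Sum>b<k. centered_perm_block k s v w a b * x b)\<^sup>2) \<le> (\<Sum>b<k. (x b)\<^sup>2)"
      using centered_perm_block_contraction by blast
  next
    fix s v w a b assume "{v, w} \<in> E"
    then have "v \<noteq> w" by (rule edge_neq)
    then show "centered_perm_block k s v w a b = centered_perm_block k s w v b a"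
      by (simp add: centered_perm_block_def)
  qed
qed

section \<open>Adjacency in the lift\<close>

lemma mult_add_eq_iff:
  fixes a b k :: nat
  assumes "a < k" "b < k"
  shows "v * k + a = w * k + b \<longleftrightarrow> v = w \<and> a = b"
proof
  assume eq: "v * k + a = w * k + b"
  have "(v * k + a) div k = v" "(w * k + b) div k = w" "(v * k + a) mod k = a" "(w * k + b) mod k = b"
    using assms by simp_all
  then show "v = w \<and> a = b" using eq by metis
qed simp

text \<open>\<open>lift_edges\<close> lists each matching from the smaller endpoint only; here
  adjacency is read in both directions. Quotient and remainder by \<open>k\<close> recover the base
  vertex and the copy.\<close>

lemma mem_lift_edges_iff:
  assumes "simple_graph n E" and perm: "\<And>e. e \<in> E \<Longrightarrow> \<pi> e permutes {..<k}" and "a < k" "b < k"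
  shows "{v * k + a, w * k + b} \<in> lift_edges k E \<pi> \<longleftrightarrow>
    {v, w} \<in> E \<and> (if v < w then \<pi> {v, w} a = b else \<pi> {v, w} b = a)"
proof -
  interpret simple_finite_graph n E by unfold_locales (rule assms)
  have lt: "\<pi> e c < k" if "e \<in> E" "c < k" for e c
    using permutes_in_image[OF perm[OF that(1)], of c] that by simp
  show ?thesis
  proof
    assume "{v * k + a, w * k + b} \<in> lift_edges k E \<pi>"
    then obtain i j c where ijc: "{i, j} \<in> E" "i < j" "c < k"
      and eq: "{v * k + a, w * k + b} = {i * k + c, j * k + \<pi> {i, j} c}"
      unfolding lift_edges_def by blast
    from eq consider "v * k + a = i * k + c" "w * k + b = j * k + \<pi> {i, j} c"
      | "v * k + a = j * k + \<pi> {i, j} c" "w * k + b = i * k + c"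
      by (auto simp: doubleton_eq_iff)
    then show "{v, w} \<in> E \<and> (if v < w then \<pi> {v, w} a = b else \<pi> {v, w} b = a)"
    proof cases
      case 1
      then show ?thesis using ijc lt[OF ijc(1,3)] assms(3,4) by (simp add: mult_add_eq_iff)
    next
      case 2
      then show ?thesis using ijc lt[OF ijc(1,3)] assms(3,4) by (simp add: mult_add_eq_iff insert_commute)
    qed
  next
    assume R: "{v, w} \<in> E \<and> (if v < w then \<pi> {v, w} a = b else \<pi> {v, w} b = a)"
    then have "v \<noteq> w" using edge_neq by blast
    then consider "v < w" | "w < v" by linarith
    then show "{v * k + a, w * k + b} \<in> lift_edges k E \<pi>"
    proof cases
      case 1
      then have "{v * k + a, w * k + b} = {v * k + a, w * k + \<pi> {v, w} a}" using R by simp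
      then show ?thesis unfolding lift_edges_def using R 1 assms(3) by blast
    next
      case 2
      then have "{v * k + a, w * k + b} = {w * k + b, v * k + \<pi> {w, v} b}"
        using R by (simp add: insert_commute)
      moreover have "{w, v} \<in> E" using R by (simp add: insert_commute)
      ultimately show ?thesis unfolding lift_edges_def using 2 assms(4) by blast
    qed
  qed
qed

section \<open>Choice of the moment order and conclusion\<close>

lemma exists_moment_order:
  fixes N :: nat and \<epsilon> :: real
  assumes "N \<ge> 2" "0 < \<epsilon>" "\<epsilon> \<le> 1 / 2"
  shows "\<exists>p>0. real N \<le> (1 + \<epsilon>) ^ (2 * p) \<and> sqrt (real p) \<le> 2 / sqrt (ln (1 + \<epsilon>)) * sqrt (ln (real N))"
proof -
  define L l where "L = ln (real N)" and "l = ln (1 + \<epsilon>)"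
  \<comment> \<open>The least \<open>p\<close> with \<open>L \<le> 2 * p * l\<close>, which is the
    logarithm of the first claim.\<close>
  define p where "p = nat \<lceil>L / (2 * l)\<rceil>"
  have l: "0 < l" "l \<le> 1 / 2"
    using assms ln_add_one_self_le_self[of \<epsilon>] by (auto simp: l_def)
  have "ln 2 \<le> L" using assms by (simp add: L_def)
  then have L: "L \<ge> 2 / 3" using ln2_ge_two_thirds by linarith
  have pos: "L / (2 * l) > 0" using L l by simp
  have ge: "L / (2 * l) \<le> real p" unfolding p_def by linarith
  have "real p \<le> L / (2 * l) + 1" unfolding p_def using pos by linarith
  \<comment> \<open>From \<open>L \<ge> 2 / 3\<close> and \<open>l \<le> 1 / 2\<close> follows
    \<open>L / l \<ge> 4 / 3\<close>, so the 1 lost by rounding up is absorbed.\<close>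
  also have "\<dots> \<le> 4 * (L / l)" using L l by (simp add: field_simps)
  finally have "sqrt (real p) \<le> sqrt (4 * (L / l))" by simp
  also have "\<dots> = 2 / sqrt l * sqrt L" by (simp add: real_sqrt_mult real_sqrt_divide)
  finally have sq: "sqrt (real p) \<le> 2 / sqrt l * sqrt L" .
  have "L \<le> real (2 * p) * l" using ge l by (simp add: field_simps)
  also have "\<dots> = ln ((1 + \<epsilon>) ^ (2 * p))"
    using assms unfolding l_def by (subst ln_realpow) auto
  finally have "real N \<le> (1 + \<epsilon>) ^ (2 * p)"
    using assms unfolding L_def by (subst (asm) ln_le_cancel_iff) auto
  moreover have "p > 0" using pos ge by linarith
  ultimately show ?thesis using sq unfolding L_def l_def by blast
qed

theorem theorem1p5:
  "\<exists>C::real. C > 0 \<and>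
     (\<forall>(n::nat) (E::nat set set) (k::nat) (\<epsilon>::real).
        n \<ge> 1 \<longrightarrow> simple_graph n E \<longrightarrow> k \<ge> 2 \<longrightarrow> 0 < \<epsilon> \<longrightarrow> \<epsilon> \<le> 1 / 2 \<longrightarrow>
        measure_pmf.expectation (random_lift_mat n k E)
            (\<lambda>A. spectral_norm (A - expectation_mat (k * n) (random_lift_mat n k E)))
          \<le> 2 * (1 + \<epsilon>) * sqrt (real (max_degree n E))
             + C / sqrt (ln (1 + \<epsilon>)) * sqrt (ln (real (k * n))))"
proof (intro exI[of _ 18] conjI allI impI)
  fix n k :: nat and E :: "nat set set" and \<epsilon> :: real
  assume n: "n \<ge> 1" and simple: "simple_graph n E" and k: "k \<ge> 2" and \<epsilon>: "0 < \<epsilon>" "\<epsilon> \<le> 1 / 2"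
  let ?P = "{s. s permutes {..<k}}"
  interpret lift: centered_lift n E k ?P id "centered_perm_block k"
    by (rule centered_lift_perm[OF simple])
  let ?\<Omega> = lift.outcomes and ?A = "\<lambda>\<pi>. adjacency_mat (k * n) (lift_edges k E \<pi>)"
  let ?M = "expectation_mat (k * n) (random_lift_mat n k E)"
  let ?mean = "\<lambda>i j. if {i div k, j div k} \<in> E then 1 / real k else 0"
  \<comment> \<open>The product of the uniform distributions is uniform on \<open>outcomes\<close>,
    so every expectation is a finite average.\<close>
  have expectation: "measure_pmf.expectation (random_lift_mat n k E) g
      = (\<Sum>\<pi>\<in>?\<Omega>. g (?A \<pi>)) / real (card ?\<Omega>)" for g :: "real mat \<Rightarrow> real"
    unfolding random_lift_mat_def random_lift_def
    using Pi_pmf_of_set[of E "\<lambda>_. ?P" id] lift.finite_E lift.finite_P lift.P_nonempty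
      integral_pmf_of_set[OF lift.outcomes_nonempty lift.finite_outcomes]
    by (simp add: lift.outcomes_def)
  have entry: "?A \<pi> $$ (i, j) = lift.lift_entry \<pi> i j + ?mean i j"
    if "\<pi> \<in> ?\<Omega>" "i < k * n" "j < k * n" for \<pi> i j
  proof -
    have "{i, j} \<in> lift_edges k E \<pi> \<longleftrightarrow> {i div k, j div k} \<in> E \<and>
      (if i div k < j div k then \<pi> {i div k, j div k} (i mod k) = j mod k
       else \<pi> {i div k, j div k} (j mod k) = i mod k)"
      using mem_lift_edges_iff[of n E \<pi> k "i mod k" "j mod k" "i div k" "j div k"]
        simple lift.outcomes_mem[OF that(1)] k by simp
    then show ?thesis
      using that by (simp add: adjacency_mat_def lift.lift_entry_def centered_perm_block_def)
  qed
  \<comment> \<open>Each centered entry averages to zero by resampling its edge, so the expected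
    matrix is \<open>?mean\<close>, and subtracting it leaves exactly
    \<open>lift_entry\<close>.\<close>
  have M: "?M $$ (i, j) = ?mean i j" if "i < k * n" "j < k * n" for i j
  proof -
    have "(\<Sum>\<pi>\<in>?\<Omega>. lift.lift_entry \<pi> i j) = 0"
    proof (cases "{i div k, j div k} \<in> E")
      case True
      show ?thesis unfolding lift.outcomes_def
        by (rule sum_PiE_dflt_eq_0[OF lift.finite_E lift.finite_P lift.P_nonempty True])
          (use True k lift.centered[OF True] in \<open>simp add: lift.lift_entry_def\<close>)
    qed (simp add: lift.lift_entry_def)
    then have "(\<Sum>\<pi>\<in>?\<Omega>. ?A \<pi> $$ (i, j)) = real (card ?\<Omega>) * ?mean i j"
      using entry that by (simp add: sum.distrib)
    moreover have "card ?\<Omega> > 0"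
      using lift.finite_outcomes lift.outcomes_nonempty by (simp add: card_gt_0_iff)
    ultimately show ?thesis
      using that by (simp add: expectation_mat_def expectation)
  qed
  have kn: "k * n \<ge> 2" using mult_le_mono[OF k n] by simp
  obtain p where p: "p > 0" "real (k * n) \<le> (1 + \<epsilon>) ^ (2 * p)"
    "sqrt (real p) \<le> 2 / sqrt (ln (1 + \<epsilon>)) * sqrt (ln (real (k * n)))"
    using exists_moment_order[OF kn \<epsilon>] that by (elim exE conjE)
  let ?T = "\<lambda>\<pi>. \<Sum>i<n * k. (mat_op (n * k) (lift.lift_entry \<pi>) ^^ (2 * p)) (unit_fun i) i"
  have "spectral_norm (?A \<pi> - ?M) \<le> root (2 * p) (?T \<pi>)" if "\<pi> \<in> ?\<Omega>" for \<pi>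
  proof (rule spectral_norm_le_root_trace)
    show "?A \<pi> - ?M \<in> carrier_mat (n * k) (n * k)"
      unfolding mult.commute[of n k] by (intro minus_carrier_mat) (simp add: expectation_mat_def)
    show "(?A \<pi> - ?M) $$ (i, j) = lift.lift_entry \<pi> i j" if ij: "i < n * k" "j < n * k" for i j
    proof -
      have ij': "i < k * n" "j < k * n" using ij by (simp_all add: mult.commute)
      then have "(?A \<pi> - ?M) $$ (i, j) = ?A \<pi> $$ (i, j) - ?M $$ (i, j)"
        by (intro index_minus_mat) (simp_all add: expectation_mat_def)
      then show ?thesis using entry[OF \<open>\<pi> \<in> ?\<Omega>\<close> ij'] M[OF ij'] by simp
    qed
    show "lift.lift_entry \<pi> i j = lift.lift_entry \<pi> j i" if "i < n * k" "j < n * k" for i j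
      by (rule lift.lift_entry_sym[OF \<open>\<pi> \<in> ?\<Omega>\<close> that])
  qed (rule p(1))
  then have "(\<Sum>\<pi>\<in>?\<Omega>. spectral_norm (?A \<pi> - ?M)) / real (card ?\<Omega>)
      \<le> (\<Sum>\<pi>\<in>?\<Omega>. root (2 * p) (?T \<pi>)) / real (card ?\<Omega>)"
    by (intro divide_right_mono sum_mono) auto
  also have "\<dots> \<le> (1 + \<epsilon>) * (2 * sqrt (real (max_degree n E)) + 6 * sqrt (real p))"
    using p \<epsilon> by (intro lift.average_root_trace_le) (simp_all add: mult.commute)
  also have "\<dots> = 2 * (1 + \<epsilon>) * sqrt (real (max_degree n E)) + 6 * (1 + \<epsilon>) * sqrt (real p)"
    by (simp add: algebra_simps)
  \<comment> \<open>As \<open>1 + \<epsilon> \<le> 3 / 2\<close>, the factor 6 becomes 9, and the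
    bound on \<open>sqrt p\<close> doubles it to 18.\<close>
  also have "\<dots> \<le> 2 * (1 + \<epsilon>) * sqrt (real (max_degree n E)) + 9 * sqrt (real p)"
    using \<epsilon> by (intro add_left_mono mult_right_mono) auto
  also have "\<dots> \<le> 2 * (1 + \<epsilon>) * sqrt (real (max_degree n E))
      + 18 / sqrt (ln (1 + \<epsilon>)) * sqrt (ln (real (k * n)))"
    using p(3) by simp
  finally show "measure_pmf.expectation (random_lift_mat n k E) (\<lambda>A. spectral_norm (A - ?M))
      \<le> 2 * (1 + \<epsilon>) * sqrt (real (max_degree n E))
        + 18 / sqrt (ln (1 + \<epsilon>)) * sqrt (ln (real (k * n)))"
    by (simp only: expectation)
qed simp

end
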